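(* Let $K\in\{\mathbb{R},\mathbb{C},\mathbb{H}\}$, let $M>k\ge 1$ be integers, and let $C\in K^{M\times M}$ be a Gram matrix of unit representatives of a tight simplex (with $M$ points) in $K\mathbb{P}^{k-1}$, with $|C_{ij}|=\beta$ for all $i\neq j$. Let $b\ge 1$ be an integer. Then for any real $p\ne 0,1$, and also for $p=\infty$, there exists a projective code of $bM$ points (not necessarily distinct) in $K\mathbb{P}^{bM-k-1}$ such that the Gram matrix $A\in K^{bM\times bM}$ of its unit representatives in $K^{bM-k}$ satisfies $$\left(\sum_{i\neq j}|A_{ij}|^p\right)^{\frac1p}=\frac{bM}{\left((bM)^2\left(\beta^{\frac{p}{p-1}}+\frac1M\left(1-\beta^{\frac{p}{p-1}}\right)\right)-bM\right)^{1-\frac1p}}.$$ For $p=\infty$, the left-hand side is understood as $\max_{i\ne j}|A_{ij}|$, and on the right-hand side $\frac{p}{p-1}$ is read as $1$ and $1-\frac1p$ as $1$.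
   Context: $K^n$ carries the Hermitian product $\langle x,y\rangle=x^*y$ (for $K=\mathbb{H}$, $K^n$ is a right vector space). $K\mathbb{P}^{n-1}=(K^n\setminus\{0\})/K^\times$ with $x\sim xe$, $e\in K^\times$; points are represented by unit vectors of $K^n$. The Gram matrix of $x_1,\ldots,x_m$ has entries $\langle x_i,x_j\rangle$. A regular simplex in $K\mathbb{P}^{k-1}$ is a set of distinct points $\{x_1,\ldots,x_M\}$ such that $|\langle x_i,x_j\rangle|$ (for unit representatives) is the same for all $i\ne j$. It is called a tight simplex if this common value $\beta$ satisfies $\beta^2=\frac{M-k}{k(M-1)}$ (the smallest value allowed by the Welch bound). *)

theory Defs
  imports Complex_Main "Jordan_Normal_Form.Matrix"
begin

section \<open>Quaternions\<close>

text \<open>\<open>Quat a b c d\<close> is $a + b i + c j + d k$ with $ij = k$, $jk = i$, $ki = j$.\<close>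

codatatype quat = Quat (Q1: real) (Qi: real) (Qj: real) (Qk: real)

lemma quat_eq_iff: "x = y \<longleftrightarrow> Q1 x = Q1 y \<and> Qi x = Qi y \<and> Qj x = Qj y \<and> Qk x = Qk y"
  by (auto intro: quat.expand)

instantiation quat :: ab_group_add
begin

primcorec zero_quat where
  "Q1 0 = 0" | "Qi 0 = 0" | "Qj 0 = 0" | "Qk 0 = 0"

primcorec plus_quat where
  "Q1 (x + y) = Q1 x + Q1 y"
| "Qi (x + y) = Qi x + Qi y"
| "Qj (x + y) = Qj x + Qj y"
| "Qk (x + y) = Qk x + Qk y"

primcorec uminus_quat where
  "Q1 (- x) = - Q1 x"
| "Qi (- x) = - Qi x"
| "Qj (- x) = - Qj x"
| "Qk (- x) = - Qk x"

primcorec minus_quat where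
  "Q1 (x - y) = Q1 x - Q1 y"
| "Qi (x - y) = Qi x - Qi y"
| "Qj (x - y) = Qj x - Qj y"
| "Qk (x - y) = Qk x - Qk y"

instance
  by standard (simp_all add: quat_eq_iff)

end

instantiation quat :: ring_1
begin

primcorec one_quat where
  "Q1 1 = 1" | "Qi 1 = 0" | "Qj 1 = 0" | "Qk 1 = 0"

primcorec times_quat where
  "Q1 (x * y) = Q1 x * Q1 y - Qi x * Qi y - Qj x * Qj y - Qk x * Qk y"
| "Qi (x * y) = Q1 x * Qi y + Qi x * Q1 y + Qj x * Qk y - Qk x * Qj y"
| "Qj (x * y) = Q1 x * Qj y - Qi x * Qk y + Qj x * Q1 y + Qk x * Qi y"
| "Qk (x * y) = Q1 x * Qk y + Qi x * Qj y - Qj x * Qi y + Qk x * Q1 y"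

instance
  by standard (simp_all add: quat_eq_iff algebra_simps)

end

instantiation quat :: real_algebra_1
begin

primcorec scaleR_quat where
  "Q1 (scaleR r x) = r * Q1 x"
| "Qi (scaleR r x) = r * Qi x"
| "Qj (scaleR r x) = r * Qj x"
| "Qk (scaleR r x) = r * Qk x"

instance
  by standard (simp_all add: quat_eq_iff algebra_simps)

end

instantiation quat :: conjugate
begin

primcorec conjugate_quat where
  "Q1 (conjugate x) = Q1 x"
| "Qi (conjugate x) = - Qi x"
| "Qj (conjugate x) = - Qj x"
| "Qk (conjugate x) = - Qk x"

instance
  by standard (simp_all add: quat_eq_iff)

end

lemma quat_sum4_eq_0:
  fixes a b c d :: real
  shows "a\<^sup>2 + b\<^sup>2 + c\<^sup>2 + d\<^sup>2 = 0 \<longleftrightarrow> a = 0 \<and> b = 0 \<and> c = 0 \<and> d = 0"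
proof
  assume h: "a\<^sup>2 + b\<^sup>2 + c\<^sup>2 + d\<^sup>2 = 0"
  have "a\<^sup>2 \<ge> 0" "b\<^sup>2 \<ge> 0" "c\<^sup>2 \<ge> 0" "d\<^sup>2 \<ge> 0" by simp_all
  with h have "a\<^sup>2 = 0" "b\<^sup>2 = 0" "c\<^sup>2 = 0" "d\<^sup>2 = 0" by linarith+
  then show "a = 0 \<and> b = 0 \<and> c = 0 \<and> d = 0" by simp
qed simp

instantiation quat :: real_div_algebra
begin

definition inverse_quat :: "quat \<Rightarrow> quat" where
  "inverse x = scaleR (1 / ((Q1 x)\<^sup>2 + (Qi x)\<^sup>2 + (Qj x)\<^sup>2 + (Qk x)\<^sup>2)) (conjugate x)"

definition divide_quat :: "quat \<Rightarrow> quat \<Rightarrow> quat" where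
  "x div y = x * inverse y" for x y :: quat

instance
proof
  fix x y :: quat
  show "inverse (0::quat) = 0"
    by (simp add: inverse_quat_def quat_eq_iff)
  show "x div y = x * inverse y"
    by (simp add: divide_quat_def)
  assume "x \<noteq> 0"
  then have nz: "(Q1 x)\<^sup>2 + (Qi x)\<^sup>2 + (Qj x)\<^sup>2 + (Qk x)\<^sup>2 \<noteq> 0" (is "?n \<noteq> 0")
    by (simp add: quat_sum4_eq_0 quat_eq_iff)
  have "conjugate x * x = scaleR ?n 1" "x * conjugate x = scaleR ?n 1"
    by (simp_all add: quat_eq_iff power2_eq_square algebra_simps)
  then show "inverse x * x = 1" "x * inverse x = 1"
    using nz by (simp_all add: inverse_quat_def)
qed

end

lemma quat_sqrt4_triangle:
  fixes a b c d a' b' c' d' :: real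
  shows "sqrt ((a + a')\<^sup>2 + (b + b')\<^sup>2 + (c + c')\<^sup>2 + (d + d')\<^sup>2)
    \<le> sqrt (a\<^sup>2 + b\<^sup>2 + c\<^sup>2 + d\<^sup>2) + sqrt (a'\<^sup>2 + b'\<^sup>2 + c'\<^sup>2 + d'\<^sup>2)"
proof -
  define s where "s = sqrt (a\<^sup>2 + b\<^sup>2)"
  define t where "t = sqrt (c\<^sup>2 + d\<^sup>2)"
  define s' where "s' = sqrt (a'\<^sup>2 + b'\<^sup>2)"
  define t' where "t' = sqrt (c'\<^sup>2 + d'\<^sup>2)"
  have sq: "s\<^sup>2 = a\<^sup>2 + b\<^sup>2" "t\<^sup>2 = c\<^sup>2 + d\<^sup>2" "s'\<^sup>2 = a'\<^sup>2 + b'\<^sup>2" "t'\<^sup>2 = c'\<^sup>2 + d'\<^sup>2"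
    by (simp_all add: s_def t_def s'_def t'_def)
  have "sqrt ((a + a')\<^sup>2 + (b + b')\<^sup>2) \<le> s + s'"
    unfolding s_def s'_def by (rule real_sqrt_sum_squares_triangle_ineq)
  then have 1: "(a + a')\<^sup>2 + (b + b')\<^sup>2 \<le> (s + s')\<^sup>2"
    using sqrt_le_D by blast
  have "sqrt ((c + c')\<^sup>2 + (d + d')\<^sup>2) \<le> t + t'"
    unfolding t_def t'_def by (rule real_sqrt_sum_squares_triangle_ineq)
  then have 2: "(c + c')\<^sup>2 + (d + d')\<^sup>2 \<le> (t + t')\<^sup>2"
    using sqrt_le_D by blast
  have "sqrt ((a + a')\<^sup>2 + (b + b')\<^sup>2 + (c + c')\<^sup>2 + (d + d')\<^sup>2) \<le> sqrt ((s + s')\<^sup>2 + (t + t')\<^sup>2)"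
    using 1 2 by (intro real_sqrt_le_mono) linarith
  also have "\<dots> \<le> sqrt (s\<^sup>2 + t\<^sup>2) + sqrt (s'\<^sup>2 + t'\<^sup>2)"
    by (rule real_sqrt_sum_squares_triangle_ineq)
  finally show ?thesis
    by (simp add: sq add.assoc)
qed

instantiation quat :: real_normed_div_algebra
begin

definition norm_quat :: "quat \<Rightarrow> real" where
  "norm x = sqrt ((Q1 x)\<^sup>2 + (Qi x)\<^sup>2 + (Qj x)\<^sup>2 + (Qk x)\<^sup>2)"

definition sgn_quat :: "quat \<Rightarrow> quat" where
  "sgn x = x /\<^sub>R norm x" for x :: quat

definition dist_quat :: "quat \<Rightarrow> quat \<Rightarrow> real" where
  "dist x y = norm (x - y)" for x y :: quat

definition uniformity_quat :: "(quat \<times> quat) filter" where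
  "uniformity_quat = (INF e\<in>{0 <..}. principal {(x, y). dist x y < e})"

definition open_quat :: "quat set \<Rightarrow> bool" where
  "open_quat U \<longleftrightarrow> (\<forall>x\<in>U. eventually (\<lambda>(x', y). x' = x \<longrightarrow> y \<in> U) uniformity)"

instance
proof
  fix r :: real and x y :: quat and S :: "quat set"
  show "(norm x = 0) = (x = 0)"
    by (simp add: norm_quat_def quat_sum4_eq_0 quat_eq_iff)
  show "norm (x + y) \<le> norm x + norm y"
    by (simp add: norm_quat_def quat_sqrt4_triangle)
  show "norm (scaleR r x) = \<bar>r\<bar> * norm x"
    by (simp add: norm_quat_def power_mult_distrib distrib_left [symmetric] real_sqrt_mult)
  show "norm (x * y) = norm x * norm y"
    by (simp add: norm_quat_def real_sqrt_mult [symmetric] power2_eq_square algebra_simps)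
qed (rule sgn_quat_def dist_quat_def open_quat_def uniformity_quat_def)+

end


section \<open>Projective spaces\<close>

text \<open>
  The scalar type ranges over \<^typ>\<open>real\<close>, \<^typ>\<open>complex\<close> and \<^typ>\<open>quat\<close>. Scalars act on vectors
  from the right, so the scalar multiplication of the matrix library, which acts from the left,
  is not used. Likewise the library's \<open>\<bullet>c\<close> conjugates the second factor; here the
  first one is conjugated.
\<close>

definition herm_prod :: "'a::{real_normed_div_algebra,conjugate} vec \<Rightarrow> 'a vec \<Rightarrow> 'a" where
  "herm_prod x y = scalar_prod (conjugate x) y"

definition proj_rel :: "nat \<Rightarrow> ('a::{real_normed_div_algebra,conjugate} vec \<times> 'a vec) set" where
  "proj_rel n = {(x, y). x \<in> carrier_vec n - {0\<^sub>v n} \<and> y \<in> carrier_vec n - {0\<^sub>v n} \<and>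
     (\<exists>e. e \<noteq> 0 \<and> y = map_vec (\<lambda>t. t * e) x)}"

text \<open>The index \<open>n\<close> counts homogeneous coordinates: this is $K\mathbb{P}^{n-1}$.\<close>

definition proj_space :: "nat \<Rightarrow> 'a::{real_normed_div_algebra,conjugate} vec set set" where
  "proj_space n = (carrier_vec n - {0\<^sub>v n}) // proj_rel n"

lemma equiv_proj_rel:
  "equiv (carrier_vec n - {0\<^sub>v n})
    (proj_rel n :: ('a::{real_normed_div_algebra,conjugate} vec \<times> 'a vec) set)"
proof (rule equivI)
  show "proj_rel n \<subseteq> (carrier_vec n - {0\<^sub>v n :: 'a vec}) \<times> (carrier_vec n - {0\<^sub>v n})"
    by (auto simp: proj_rel_def)
  show "refl_on (carrier_vec n - {0\<^sub>v n}) (proj_rel n :: ('a vec \<times> 'a vec) set)"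
    by (auto simp: refl_on_def proj_rel_def intro!: exI[of _ 1])
  show "sym (proj_rel n :: ('a vec \<times> 'a vec) set)"
  proof (rule symI)
    fix x y :: "'a vec"
    assume "(x, y) \<in> proj_rel n"
    then obtain e where "e \<noteq> 0" "y = map_vec (\<lambda>t. t * e) x"
      and c: "x \<in> carrier_vec n - {0\<^sub>v n}" "y \<in> carrier_vec n - {0\<^sub>v n}"
      by (auto simp: proj_rel_def)
    then have "inverse e \<noteq> 0" "x = map_vec (\<lambda>t. t * inverse e) y"
      by (auto simp: mult.assoc)
    with c show "(y, x) \<in> proj_rel n"
      unfolding proj_rel_def by blast
  qed
  show "trans (proj_rel n :: ('a vec \<times> 'a vec) set)"
  proof (rule transI)
    fix x y z :: "'a vec"
    assume "(x, y) \<in> proj_rel n" "(y, z) \<in> proj_rel n"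
    then obtain e f where "e \<noteq> 0" "y = map_vec (\<lambda>t. t * e) x" "f \<noteq> 0" "z = map_vec (\<lambda>t. t * f) y"
      and c: "x \<in> carrier_vec n - {0\<^sub>v n}" "z \<in> carrier_vec n - {0\<^sub>v n}"
      by (auto simp: proj_rel_def)
    then have "e * f \<noteq> 0" "z = map_vec (\<lambda>t. t * (e * f)) x"
      by (auto simp: mult.assoc)
    with c show "(x, z) \<in> proj_rel n"
      unfolding proj_rel_def by blast
  qed
qed

definition unit_rep :: "'a::{real_normed_div_algebra,conjugate} vec set \<Rightarrow> 'a vec \<Rightarrow> bool" where
  "unit_rep P x \<longleftrightarrow> x \<in> P \<and> herm_prod x x = 1"

definition gram_matrix :: "nat \<Rightarrow> (nat \<Rightarrow> 'a::{real_normed_div_algebra,conjugate} vec) \<Rightarrow> 'a mat" where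
  "gram_matrix N x = mat N N (\<lambda>(i, j). herm_prod (x i) (x j))"

definition gram_of_unit_reps ::
  "nat \<Rightarrow> (nat \<Rightarrow> 'a::{real_normed_div_algebra,conjugate} vec set) \<Rightarrow> 'a mat \<Rightarrow> bool" where
  "gram_of_unit_reps N P G \<longleftrightarrow> (\<exists>x. (\<forall>i<N. unit_rep (P i) (x i)) \<and> G = gram_matrix N x)"


section \<open>Codes and simplices\<close>

text \<open>The points \<open>P 0\<close>, \dots, \<open>P (N - 1)\<close> of a code need not be distinct.\<close>

definition projective_code ::
  "nat \<Rightarrow> nat \<Rightarrow> (nat \<Rightarrow> 'a::{real_normed_div_algebra,conjugate} vec set) \<Rightarrow> bool" where
  "projective_code n N P \<longleftrightarrow> (\<forall>i<N. P i \<in> proj_space n)"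

definition regular_simplex ::
  "nat \<Rightarrow> real \<Rightarrow> 'a::{real_normed_div_algebra,conjugate} vec set set \<Rightarrow> bool" where
  "regular_simplex n \<beta> S \<longleftrightarrow> finite S \<and> S \<subseteq> proj_space n \<and>
     (\<forall>P\<in>S. \<forall>Q\<in>S. P \<noteq> Q \<longrightarrow>
        (\<forall>x y. unit_rep P x \<longrightarrow> unit_rep Q y \<longrightarrow> norm (herm_prod x y) = \<beta>))"

definition tight_simplex ::
  "nat \<Rightarrow> 'a::{real_normed_div_algebra,conjugate} vec set set \<Rightarrow> bool" where
  "tight_simplex n S \<longleftrightarrow> (\<exists>\<beta>. regular_simplex n \<beta> S \<and>
     \<beta>\<^sup>2 = (real (card S) - real n) / (real n * (real (card S) - 1)))"


section \<open>Norms of the off-diagonal part of a matrix\<close>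

text \<open>
  For negative \<open>p\<close> a vanishing off-diagonal entry contributes $0^p = \infty$, and
  $\infty^{1/p} = 0$. Since \<open>0 powr p = 0\<close>, this case is treated separately.
\<close>

definition offdiag_norm :: "real \<Rightarrow> 'a::real_normed_vector mat \<Rightarrow> real" where
  "offdiag_norm p A =
     (if p < 0 \<and> (\<exists>i<dim_row A. \<exists>j<dim_col A. i \<noteq> j \<and> A $$ (i, j) = 0) then 0
      else (\<Sum>(i, j)\<in>{(i, j). i < dim_row A \<and> j < dim_col A \<and> i \<noteq> j}.
              norm (A $$ (i, j)) powr p) powr (1 / p))"

definition offdiag_max :: "'a::real_normed_vector mat \<Rightarrow> real" where
  "offdiag_max A = Max {norm (A $$ (i, j)) | i j. i < dim_row A \<and> j < dim_col A \<and> i \<noteq> j}"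

end

theory Submission
  imports Defs
begin

text \<open>
  Equality in the Welch bound means that the Gram matrix \<open>C\<close> is \<open>M/k\<close> times a projection of rank
  \<open>k\<close>. Put \<open>q = p/(p - 1)\<close> and blow \<open>C\<close> up to \<open>G = C \<otimes> J\<close> with \<open>J\<close> the all-ones \<open>b \<times> b\<close> matrix.
  A Gram matrix \<open>A\<close> with \<open>A G = 0\<close> satisfies \<open>\<Sum> A\<^sub>i\<^sub>j G\<^sub>j\<^sub>i = - b M\<close> over \<open>i \<noteq> j\<close>, and the right-hand side
  of the theorem is \<open>b M\<close> divided by the off-diagonal \<open>q\<close>-norm of \<open>G\<close>, the equality case of
  Hoelder's inequality. Hence the off-diagonal entries of \<open>A\<close> have to be \<open>- c |G\<^sub>i\<^sub>j| powr (q - 2)\<close>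
  times \<open>G\<^sub>i\<^sub>j\<close>. This \<open>A\<close> is a positive combination of the orthogonal projections
  \<open>I \<otimes> (I - J/b)\<close> and \<open>(I - (k/M) C) \<otimes> J/b\<close>, whose ranks add up to \<open>b M - k\<close>, so it is a Gram matrix
  of vectors in that dimension.
\<close>

section \<open>Scalars with a conjugation\<close>

text \<open>The axioms hold over the quaternions too, so one noncommutative argument serves all
  three scalar types. That conjugation is an involution is inherited from
  \<open>conjugate\<close>.\<close>

class hermitian_scalar = real_normed_div_algebra + conjugate +
  assumes conjugate_mult_rev: "conjugate (x * y) = conjugate y * conjugate x"
    and conjugate_plus: "conjugate (x + y) = conjugate x + conjugate y"
    and conjugate_mult_scaleR: "conjugate x * x = ((norm x)\<^sup>2) *\<^sub>R 1"

lemma conjugate_mult_self: "conjugate x * x = (of_real ((norm x)\<^sup>2) :: 'a::hermitian_scalar)"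
  by (simp only: conjugate_mult_scaleR of_real_def)

instance real :: hermitian_scalar
  by standard (simp_all add: power2_eq_square)

instance complex :: hermitian_scalar
proof
  fix x y :: complex
  show "conjugate (x * y) = conjugate y * conjugate x"
    by simp
  show "conjugate (x + y) = conjugate x + conjugate y"
    by simp
  show "conjugate x * x = ((norm x)\<^sup>2) *\<^sub>R 1"
    by (metis complex_norm_square conjugate_complex_def mult.commute mult.right_neutral scaleR_conv_of_real)
qed

instance quat :: hermitian_scalar
proof
  fix x y :: quat
  show "conjugate (x * y) = conjugate y * conjugate x"
    by (simp add: quat_eq_iff algebra_simps)
  show "conjugate (x + y) = conjugate x + conjugate y"
    by (simp add: quat_eq_iff)
  show "conjugate x * x = ((norm x)\<^sup>2) *\<^sub>R 1"
    by (simp add: quat_eq_iff norm_quat_def power2_eq_square algebra_simps)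
qed

lemma conjugate_0 [simp]: "conjugate (0 :: 'a::hermitian_scalar) = 0"
  using conjugate_plus[of 0 "0 :: 'a"] by simp

lemma conjugate_uminus: "conjugate (- x :: 'a::hermitian_scalar) = - conjugate x"
  using conjugate_plus[of x "- x"] by (simp add: eq_neg_iff_add_eq_0 add.commute)

lemma conjugate_minus: "conjugate (x - y :: 'a::hermitian_scalar) = conjugate x - conjugate y"
  using conjugate_plus[of x "- y"] by (simp add: conjugate_uminus)

lemma conjugate_sum: "conjugate (sum f A :: 'a::hermitian_scalar) = (\<Sum>x\<in>A. conjugate (f x))"
  by (induction A rule: infinite_finite_induct) (simp_all add: conjugate_plus)

text \<open>A nonnegative real has the form \<open>conjugate s * s\<close>, which product-reversing
  conjugation fixes; negative reals follow by additivity.\<close>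

lemma conjugate_of_real [simp]: "conjugate (of_real r :: 'a::hermitian_scalar) = of_real r"
proof -
  have nonneg: "conjugate (of_real t :: 'a) = of_real t" if "t \<ge> 0" for t
  proof -
    let ?s = "of_real (sqrt t) :: 'a"
    have "conjugate (conjugate ?s * ?s) = conjugate ?s * ?s"
      by (simp add: conjugate_mult_rev)
    moreover have "conjugate ?s * ?s = of_real t"
      using that by (simp add: conjugate_mult_self)
    ultimately show ?thesis
      by (simp only:)
  qed
  show ?thesis
  proof (cases "r \<ge> 0")
    case False
    then show ?thesis
      using nonneg[of "- r"] by (simp add: conjugate_uminus)
  qed (rule nonneg)
qed

lemma conjugate_1 [simp]: "conjugate (1 :: 'a::hermitian_scalar) = 1"
  using conjugate_of_real[of 1] by simp

lemma conjugate_scaleR: "conjugate (r *\<^sub>R x :: 'a::hermitian_scalar) = r *\<^sub>R conjugate x"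
proof -
  have "conjugate (of_real r * x) = conjugate x * (r *\<^sub>R 1)"
    by (simp only: conjugate_mult_rev conjugate_of_real of_real_def[symmetric])
  then show ?thesis
    by (simp add: scaleR_conv_of_real[symmetric])
qed

lemma norm_conjugate [simp]: "norm (conjugate x :: 'a::hermitian_scalar) = norm x"
proof (cases "x = 0")
  case False
  have "norm (conjugate x) * norm x = norm (of_real ((norm x)\<^sup>2) :: 'a)"
    by (simp only: conjugate_mult_self[symmetric] norm_mult)
  also have "\<dots> = norm x * norm x"
    by (simp only: norm_of_real) (simp add: power2_eq_square)
  finally have "norm (conjugate x) * norm x = norm x * norm x" .
  with False show ?thesis by simp
qed simp

lemma mult_conjugate_self: "x * conjugate x = (of_real ((norm x)\<^sup>2) :: 'a::hermitian_scalar)"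
  using conjugate_mult_self[of "conjugate x"] by simp

text \<open>\<open>x + conjugate x\<close> plays the role of twice the real part.
  Both sides come from expanding the norm of \<open>conjugate x + y\<close>, once from each side.\<close>

lemma real_part_commute:
  "x * y + conjugate (x * y) = y * x + conjugate (y * x :: 'a::hermitian_scalar)"
proof -
  let ?z = "conjugate x + y"
  have "conjugate ?z * ?z = ?z * conjugate ?z"
    by (simp only: conjugate_mult_self mult_conjugate_self)
  then show ?thesis
    by (simp add: conjugate_plus algebra_simps conjugate_mult_rev conjugate_mult_self
        mult_conjugate_self del: of_real_power)
qed

section \<open>Equality in the Welch bound\<close>

text \<open>Both sides are the trace of a square, of the frame operator and of the Gram matrix.
  Cyclicity of the trace fails over the quaternions; it is restored by applying \<open>t\<close>,
  twice the real part, under which products commute.\<close>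

lemma frobenius_gram_frame:
  fixes X :: "nat \<Rightarrow> nat \<Rightarrow> 'a::hermitian_scalar"
  shows "(\<Sum>a<k. \<Sum>b<k. (norm (\<Sum>i<n. X a i * conjugate (X b i)))\<^sup>2)
    = (\<Sum>i<n. \<Sum>j<n. (norm (\<Sum>a<k. conjugate (X a i) * X a j))\<^sup>2)"
proof -
  define t :: "'a \<Rightarrow> 'a" where "t x = x + conjugate x" for x
  define T where "T a b = (\<Sum>i<n. X a i * conjugate (X b i))" for a b
  define C where "C i j = (\<Sum>a<k. conjugate (X a i) * X a j)" for i j
  have t_sum: "t (sum f A) = (\<Sum>x\<in>A. t (f x))" for f and A :: "nat set"
    by (simp add: t_def conjugate_sum sum.distrib)
  have t_comm: "t (x * y) = t (y * x)" for x y
    unfolding t_def by (rule real_part_commute)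
  have t_real: "t (of_real r) = of_real (2 * r)" for r
    by (simp only: t_def conjugate_of_real of_real_add[symmetric] mult_2)
  have conj_T: "conjugate (T a b) = T b a" for a b
    by (simp add: T_def conjugate_sum conjugate_mult_rev)
  have t_T: "t (T b a * T a b) = of_real (2 * (norm (T a b))\<^sup>2)" for a b
    by (simp only: conj_T[of a b, symmetric] conjugate_mult_self t_real)
  have conj_C: "conjugate (C i j) = C j i" for i j
    by (simp add: C_def conjugate_sum conjugate_mult_rev)
  have "of_real (2 * (\<Sum>a<k. \<Sum>b<k. (norm (T a b))\<^sup>2)) = (\<Sum>a<k. \<Sum>b<k. t (T b a * T a b))"
    by (simp only: t_T of_real_sum sum_distrib_left)
  also have "\<dots> = (\<Sum>a<k. \<Sum>b<k. \<Sum>i<n. \<Sum>j<n. t ((X b i * conjugate (X a i)) * (X a j * conjugate (X b j))))"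
    by (simp add: T_def sum_product t_sum)
  also have "\<dots> = (\<Sum>a<k. \<Sum>b<k. \<Sum>i<n. \<Sum>j<n. t ((conjugate (X a i) * X a j) * (conjugate (X b j) * X b i)))"
  proof -
    have "t ((X b i * conjugate (X a i)) * (X a j * conjugate (X b j)))
      = t ((conjugate (X a i) * X a j) * (conjugate (X b j) * X b i))" for a b i j
      using t_comm[of "X b i" "conjugate (X a i) * X a j * conjugate (X b j)"]
      by (simp add: mult.assoc)
    then show ?thesis by simp
  qed
  also have "\<dots> = (\<Sum>a<k. \<Sum>i<n. \<Sum>b<k. \<Sum>j<n. t ((conjugate (X a i) * X a j) * (conjugate (X b j) * X b i)))"
    by (rule sum.cong[OF refl], rule sum.swap)
  also have "\<dots> = (\<Sum>i<n. \<Sum>a<k. \<Sum>b<k. \<Sum>j<n. t ((conjugate (X a i) * X a j) * (conjugate (X b j) * X b i)))"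
    by (rule sum.swap)
  also have "\<dots> = (\<Sum>i<n. \<Sum>a<k. \<Sum>j<n. \<Sum>b<k. t ((conjugate (X a i) * X a j) * (conjugate (X b j) * X b i)))"
    by (rule sum.cong[OF refl], rule sum.cong[OF refl], rule sum.swap)
  also have "\<dots> = (\<Sum>i<n. \<Sum>j<n. \<Sum>a<k. \<Sum>b<k. t ((conjugate (X a i) * X a j) * (conjugate (X b j) * X b i)))"
    by (rule sum.cong[OF refl], rule sum.swap)
  also have "\<dots> = (\<Sum>i<n. \<Sum>j<n. t (C i j * conjugate (C i j)))"
    by (simp only: conj_C) (simp add: C_def sum_product t_sum)
  also have "\<dots> = of_real (2 * (\<Sum>i<n. \<Sum>j<n. (norm (C i j))\<^sup>2))"
    by (simp only: mult_conjugate_self t_real of_real_sum sum_distrib_left)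
  finally have "2 * (\<Sum>a<k. \<Sum>b<k. (norm (T a b))\<^sup>2) = 2 * (\<Sum>i<n. \<Sum>j<n. (norm (C i j))\<^sup>2)"
    by (simp only: of_real_eq_iff)
  then show ?thesis
    by (simp add: T_def C_def)
qed

text \<open>Equality in the Welch bound says that the frame operator \<open>T\<close> satisfies
  \<open>\<parallel>T - (n/k) I\<parallel> = 0\<close> in the Frobenius norm.\<close>

lemma tight_gram_square:
  fixes X :: "nat \<Rightarrow> nat \<Rightarrow> 'a::hermitian_scalar"
  assumes C: "\<And>i j. C i j = (\<Sum>a<k. conjugate (X a i) * X a j)"
    and diag: "\<And>i. i < n \<Longrightarrow> C i i = 1"
    and frob: "(\<Sum>i<n. \<Sum>j<n. (norm (C i j))\<^sup>2) = (real n)\<^sup>2 / real k"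
    and k: "0 < k"
  shows "(\<Sum>l<n. C i l * C l j) = (real n / real k) *\<^sub>R C i j"
proof -
  define T where "T a b = (\<Sum>i<n. X a i * conjugate (X b i))" for a b
  define s where "s = real n / real k"
  define \<tau> where "\<tau> a = (\<Sum>i<n. (norm (X a i))\<^sup>2)" for a
  have T_diag: "T a a = of_real (\<tau> a)" for a
    by (simp add: T_def \<tau>_def mult_conjugate_self)
  have "(\<Sum>a<k. \<tau> a) = (\<Sum>i<n. \<Sum>a<k. (norm (X a i))\<^sup>2)"
    unfolding \<tau>_def by (rule sum.swap)
  also have "\<dots> = (\<Sum>i<n. 1)"
  proof (rule sum.cong)
    fix i assume "i \<in> {..<n}"
    then have "C i i = 1"
      by (simp add: diag)
    moreover have "C i i = of_real (\<Sum>a<k. (norm (X a i))\<^sup>2)"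
      by (simp add: C conjugate_mult_self)
    ultimately show "(\<Sum>a<k. (norm (X a i))\<^sup>2) = 1"
      by (metis of_real_eq_1_iff)
  qed simp
  finally have tr: "(\<Sum>a<k. \<tau> a) = real n" by simp
  \<comment> \<open>\<open>s = n/k\<close> is the multiple of the identity that the frame operator
    should be. The diagonal of \<open>T\<close> is real, so the cross term is
    \<open>2 * s * \<tau> a\<close>.\<close>
  have entry: "(norm (T a b - of_bool (a = b) *\<^sub>R of_real s))\<^sup>2
      = (norm (T a b))\<^sup>2 + of_bool (a = b) * (s\<^sup>2 - 2 * s * \<tau> a)" for a b
  proof (cases "a = b")
    case True
    have "norm (T a a - of_real s) = \<bar>\<tau> a - s\<bar>"
      by (simp only: T_diag of_real_diff[symmetric] norm_of_real)
    with True show ?thesis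
      by (simp add: T_diag power2_diff)
  qed simp
  have "(\<Sum>a<k. \<Sum>b<k. (norm (T a b - of_bool (a = b) *\<^sub>R of_real s))\<^sup>2)
      = (\<Sum>a<k. \<Sum>b<k. (norm (T a b))\<^sup>2) + (\<Sum>a<k. s\<^sup>2 - 2 * s * \<tau> a)"
    by (simp only: entry sum.distrib) (simp add: of_bool_def if_distrib[where f = "\<lambda>x. x * _"] cong: if_cong)
  also have "\<dots> = (real n)\<^sup>2 / real k + (real k * s\<^sup>2 - 2 * s * real n)"
  proof -
    have "(\<Sum>a<k. \<Sum>b<k. (norm (T a b))\<^sup>2) = (real n)\<^sup>2 / real k"
      using frobenius_gram_frame[where X = X and k = k and n = n] frob by (simp add: T_def C)
    then show ?thesis
      by (simp add: sum_subtractf sum_distrib_left[symmetric] tr)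
  qed
  also have "\<dots> = 0"
    using k by (simp add: s_def power2_eq_square field_simps)
  finally have "\<forall>a\<in>{..<k}. \<forall>b\<in>{..<k}. (norm (T a b - of_bool (a = b) *\<^sub>R of_real s))\<^sup>2 = 0"
    by (subst (asm) sum_nonneg_eq_0_iff; (subst (asm) sum_nonneg_eq_0_iff)?)
      (auto intro!: sum_nonneg simp: sum_nonneg_eq_0_iff)
  then have T: "T a b = of_bool (a = b) *\<^sub>R of_real s" if "a < k" "b < k" for a b
    using that by simp
  \<comment> \<open>With X' the conjugate transpose of \<open>X\<close>, the product X' X X' X is
    regrouped as X' T X, and \<open>T\<close> is \<open>s\<close> times the identity.\<close>
  have "(\<Sum>l<n. C i l * C l j)
      = (\<Sum>l<n. \<Sum>a<k. \<Sum>b<k. conjugate (X a i) * (X a l * conjugate (X b l)) * X b j)"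
    by (simp add: C sum_product mult.assoc)
  also have "\<dots> = (\<Sum>a<k. \<Sum>l<n. \<Sum>b<k. conjugate (X a i) * (X a l * conjugate (X b l)) * X b j)"
    by (rule sum.swap)
  also have "\<dots> = (\<Sum>a<k. \<Sum>b<k. \<Sum>l<n. conjugate (X a i) * (X a l * conjugate (X b l)) * X b j)"
    by (rule sum.cong[OF refl], rule sum.swap)
  also have "\<dots> = (\<Sum>a<k. \<Sum>b<k. conjugate (X a i) * T a b * X b j)"
    by (simp add: T_def sum_distrib_left sum_distrib_right)
  also have "\<dots> = (\<Sum>a<k. \<Sum>b<k. if a = b then s *\<^sub>R (conjugate (X a i) * X a j) else 0)"
    by (intro sum.cong refl) (auto simp: T of_real_def)
  also have "\<dots> = s *\<^sub>R C i j"
    by (simp add: C scaleR_sum_right)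
  finally show ?thesis
    by (simp add: s_def)
qed

section \<open>Orthogonal projections and their factorisations\<close>

definition orth_proj :: "nat \<Rightarrow> (nat \<Rightarrow> nat \<Rightarrow> 'a::hermitian_scalar) \<Rightarrow> bool" where
  "orth_proj n Q \<longleftrightarrow> (\<forall>i<n. \<forall>j<n. conjugate (Q i j) = Q j i) \<and>
     (\<forall>i<n. \<forall>j<n. (\<Sum>l<n. Q i l * Q l j) = Q i j)"

text \<open>A Hermitian idempotent equals its conjugate transpose times itself, so its diagonal
  holds squared column norms. In particular, zero trace forces the zero matrix.\<close>

lemma orth_proj_diag:
  assumes "orth_proj n Q" "j < n"
  shows "Q j j = of_real (\<Sum>l<n. (norm (Q l j))\<^sup>2)"
proof -
  have "Q j j = (\<Sum>l<n. Q j l * Q l j)"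
    using assms by (simp add: orth_proj_def)
  also have "\<dots> = (\<Sum>l<n. conjugate (Q l j) * Q l j)"
    using assms by (intro sum.cong) (auto simp: orth_proj_def)
  finally show ?thesis
    by (simp add: conjugate_mult_self)
qed

text \<open>A projection of positive trace has a nonzero column, which it fixes; splitting off the
  normalised column lowers the trace by one.\<close>

lemma orth_proj_factor:
  assumes "orth_proj n Q" "(\<Sum>i<n. Q i i) = of_nat m"
  shows "\<exists>U. \<forall>i<n. \<forall>j<n. (\<Sum>r<m. conjugate (U r i) * U r j) = Q i j"
  using assms
proof (induction m arbitrary: Q)
  case 0
  have "of_real (\<Sum>j<n. \<Sum>l<n. (norm (Q l j))\<^sup>2) = (\<Sum>j<n. Q j j)"
    by (simp add: orth_proj_diag[OF "0.prems"(1)])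
  then have "(\<Sum>j<n. \<Sum>l<n. (norm (Q l j))\<^sup>2) = 0"
    by (simp only: "0.prems"(2) of_nat_0 of_real_eq_0_iff)
  then have "Q l j = 0" if "l < n" "j < n" for l j
    using that by (simp add: sum_nonneg_eq_0_iff sum_nonneg)
  then show ?case by simp
next
  case (Suc m)
  have herm: "conjugate (Q i l) = Q l i" and idem: "(\<Sum>t<n. Q i t * Q t l) = Q i l"
    if "i < n" "l < n" for i l
    using Suc.prems(1) that by (auto simp: orth_proj_def)
  obtain j where j: "j < n" "Q j j \<noteq> 0"
  proof (rule ccontr)
    assume "\<not> thesis"
    with that have "(\<Sum>j<n. Q j j) = 0" by (intro sum.neutral) auto
    with Suc.prems(2) show False by (metis of_nat_eq_0_iff nat.distinct(2))
  qed
  define s where "s = (\<Sum>l<n. (norm (Q l j))\<^sup>2)"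
  have Qs: "Q j j = of_real s"
    using orth_proj_diag[OF Suc.prems(1) j(1)] by (simp add: s_def)
  have s: "s > 0"
  proof -
    have "s \<noteq> 0" using j Qs by auto
    moreover have "s \<ge> 0" by (simp add: s_def sum_nonneg)
    ultimately show ?thesis by simp
  qed
  \<comment> \<open>\<open>Q j l\<close> is the conjugate of \<open>Q l j\<close>, so the subtracted
    term is column \<open>j\<close> times its conjugate transpose, divided by its squared length
    \<open>s\<close>.\<close>
  define R where "R i l = Q i l - (1 / s) *\<^sub>R (Q i j * Q j l)" for i l
  have "orth_proj n R"
    unfolding orth_proj_def
  proof (intro conjI allI impI)
    fix i l assume il: "i < n" "l < n"
    show "conjugate (R i l) = R l i"
      using il j by (simp add: R_def conjugate_minus conjugate_scaleR conjugate_mult_rev herm)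
    have "(\<Sum>t<n. R i t * R t l) = (\<Sum>t<n. Q i t * Q t l)
        - (1 / s) *\<^sub>R ((\<Sum>t<n. Q i t * Q t j) * Q j l) - (1 / s) *\<^sub>R (Q i j * (\<Sum>t<n. Q j t * Q t l))
        + (1 / s) *\<^sub>R (1 / s) *\<^sub>R (Q i j * (\<Sum>t<n. Q j t * Q t j) * Q j l)"
      by (simp add: R_def algebra_simps sum.distrib sum_subtractf sum_distrib_left
          sum_distrib_right scaleR_sum_right)
    also have "\<dots> = Q i l - (1 / s) *\<^sub>R (Q i j * Q j l) - (1 / s) *\<^sub>R (Q i j * Q j l)
        + (1 / s) *\<^sub>R (Q i j * Q j l)"
      using il j s by (simp add: idem Qs of_real_def)
    finally show "(\<Sum>t<n. R i t * R t l) = R i l"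
      by (simp add: R_def)
  qed
  moreover have "(\<Sum>i<n. R i i) = of_nat m"
  proof -
    have "(\<Sum>i<n. Q i j * Q j i) = (\<Sum>i<n. Q i j * conjugate (Q i j))"
      using j by (intro sum.cong) (auto simp: herm)
    also have "\<dots> = s *\<^sub>R 1"
      by (simp add: mult_conjugate_self s_def scaleR_conv_of_real)
    finally show ?thesis
      using Suc.prems(2) s by (simp add: R_def sum_subtractf scaleR_sum_right[symmetric])
  qed
  ultimately obtain U where U: "\<And>i l. i < n \<Longrightarrow> l < n \<Longrightarrow> (\<Sum>r<m. conjugate (U r i) * U r l) = R i l"
    using Suc.IH by blast
  \<comment> \<open>The new row \<open>m\<close> is row \<open>j\<close> of \<open>Q\<close> over
    \<open>sqrt s\<close>; it contributes exactly the rank-one term removed in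
    \<open>R\<close>.\<close>
  define V where "V r i = (if r < m then U r i else (1 / sqrt s) *\<^sub>R Q j i)" for r i
  have "(\<Sum>r<Suc m. conjugate (V r i) * V r l) = Q i l" if "i < n" "l < n" for i l
    using that j s by (simp add: V_def U conjugate_scaleR herm R_def)
  then show ?case by blast
qed

lemma orth_proj_complement:
  assumes "orth_proj n Q"
  shows "orth_proj n (\<lambda>i j. of_bool (i = j) - Q i j)"
  unfolding orth_proj_def
proof (intro conjI allI impI)
  fix i j assume ij: "i < n" "j < n"
  show "conjugate (of_bool (i = j) - Q i j) = of_bool (j = i) - Q j i"
    using assms ij by (auto simp: orth_proj_def conjugate_minus)
  have "(\<Sum>l<n. (of_bool (i = l) - Q i l) * (of_bool (l = j) - Q l j))
      = (\<Sum>l<n. if l = i then of_bool (i = j) - Q i j else 0) - (\<Sum>l<n. if l = j then Q i j else 0)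
        + (\<Sum>l<n. Q i l * Q l j)"
    unfolding sum_subtractf[symmetric] sum.distrib[symmetric]
    by (intro sum.cong) (auto simp: algebra_simps)
  also have "\<dots> = of_bool (i = j) - Q i j"
    using assms ij by (simp add: orth_proj_def)
  finally show "(\<Sum>l<n. (of_bool (i = l) - Q i l) * (of_bool (l = j) - Q l j))
      = of_bool (i = j) - Q i j" .
qed

lemma orth_proj_id: "orth_proj n (\<lambda>i j. of_bool (i = j))"
  using orth_proj_complement[of n "\<lambda>_ _. 0"] by (simp add: orth_proj_def)

section \<open>Blowing up matrices into blocks\<close>

text \<open>Each quotient \<open>a < M\<close> occurs for exactly the \<open>b\<close> indices from
  \<open>a * b\<close> to \<open>a * b + b - 1\<close>.\<close>

lemma sum_div_blocks:
  fixes f :: "nat \<Rightarrow> 'a::real_vector"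
  shows "(\<Sum>l<b * M. f (l div b)) = real b *\<^sub>R (\<Sum>a<M. f a)"
proof -
  have "(\<Sum>l<b * M. f (l div b)) = (\<Sum>a<M. \<Sum>l\<in>{a * b..<a * b + b}. f (l div b))"
    using sum.nat_group[of "\<lambda>l. f (l div b)" b M] by (simp add: mult.commute)
  also have "\<dots> = (\<Sum>a<M. \<Sum>l\<in>{a * b..<a * b + b}. f a)"
  proof (intro sum.cong refl)
    fix a l assume "l \<in> {a * b..<a * b + b}"
    then have "l div b = a"
      by (intro div_nat_eqI) (auto simp: mult.commute)
    then show "f (l div b) = f a" by simp
  qed
  finally show ?thesis
    by (simp add: scaleR_sum_right sum_constant_scaleR)
qed

text \<open>\<open>blow b F\<close> is the Kronecker product of \<open>F\<close> with the \<open>b \<times> b\<close> matrix all of whose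
  entries are \<open>1/b\<close>.\<close>

definition blow :: "nat \<Rightarrow> (nat \<Rightarrow> nat \<Rightarrow> 'a::real_vector) \<Rightarrow> nat \<Rightarrow> nat \<Rightarrow> 'a" where
  "blow b F i j = (1 / real b) *\<^sub>R F (i div b) (j div b)"

text \<open>The middle index of the product meets each block \<open>b\<close> times, which cancels
  one of the two factors \<open>1/b\<close>.\<close>

lemma orth_proj_blow:
  assumes "orth_proj M F" "0 < b"
  shows "orth_proj (b * M) (blow b F)"
  unfolding orth_proj_def
proof (intro conjI allI impI)
  fix i j assume "i < b * M" "j < b * M"
  then have ij: "i div b < M" "j div b < M"
    by (simp_all add: less_mult_imp_div_less mult.commute)
  show "conjugate (blow b F i j) = blow b F j i"
    using assms ij by (simp add: blow_def conjugate_scaleR orth_proj_def)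
  have "(\<Sum>l<b * M. blow b F i l * blow b F l j)
      = (\<Sum>l<b * M. (1 / real b) *\<^sub>R (1 / real b) *\<^sub>R (F (i div b) (l div b) * F (l div b) (j div b)))"
    by (simp add: blow_def)
  also have "\<dots> = (1 / real b) *\<^sub>R (\<Sum>a<M. F (i div b) a * F a (j div b))"
    by (subst sum_div_blocks[where f = "\<lambda>a. (1 / real b) *\<^sub>R (1 / real b) *\<^sub>R (F (i div b) a * F a (j div b))"])
      (use assms(2) in \<open>simp add: scaleR_sum_right\<close>)
  also have "\<dots> = blow b F i j"
    using assms ij by (simp add: blow_def orth_proj_def)
  finally show "(\<Sum>l<b * M. blow b F i l * blow b F l j) = blow b F i j" .
qed

lemma trace_blow:
  assumes "0 < b"
  shows "(\<Sum>i<b * M. blow b F i i) = (\<Sum>a<M. F a a)"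
proof -
  have "(\<Sum>i<b * M. blow b F i i) = (\<Sum>i<b * M. (1 / real b) *\<^sub>R F (i div b) (i div b))"
    by (simp add: blow_def)
  also have "\<dots> = (\<Sum>a<M. F a a)"
    by (subst sum_div_blocks[where f = "\<lambda>a. (1 / real b) *\<^sub>R F a a"])
      (use assms in \<open>simp add: scaleR_sum_right\<close>)
  finally show ?thesis .
qed

section \<open>Realising Gram matrices by codes\<close>

lemma sum_lessThan_add:
  fixes f :: "nat \<Rightarrow> 'a::comm_monoid_add"
  shows "sum f {..<m + n} = sum f {..<m} + (\<Sum>i<n. f (m + i))"
  by (induction n) (simp_all add: add.assoc)

text \<open>The two factors are scaled by the square roots of the coefficients and stacked, so the
  row counts, which are the ranks, add up.\<close>

lemma orth_proj_pair_factor: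
  fixes Q R :: "nat \<Rightarrow> nat \<Rightarrow> 'a::hermitian_scalar"
  assumes "orth_proj n Q" "(\<Sum>i<n. Q i i) = of_nat m"
    and "orth_proj n R" "(\<Sum>i<n. R i i) = of_nat m'"
    and "0 \<le> a" "0 \<le> d"
  shows "\<exists>Y. \<forall>i<n. \<forall>j<n. (\<Sum>r<m + m'. conjugate (Y r i) * Y r j) = a *\<^sub>R Q i j + d *\<^sub>R R i j"
proof -
  obtain U where U: "\<forall>i<n. \<forall>j<n. (\<Sum>r<m. conjugate (U r i) * U r j) = Q i j"
    using orth_proj_factor assms by blast
  obtain V where V: "\<forall>i<n. \<forall>j<n. (\<Sum>r<m'. conjugate (V r i) * V r j) = R i j"
    using orth_proj_factor assms by blast
  define Y where "Y r i = (if r < m then sqrt a *\<^sub>R U r i else sqrt d *\<^sub>R V (r - m) i)" for r i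
  have "(\<Sum>r<m + m'. conjugate (Y r i) * Y r j) = a *\<^sub>R Q i j + d *\<^sub>R R i j" if "i < n" "j < n" for i j
    using that assms(5,6) U V
    by (simp add: sum_lessThan_add Y_def conjugate_scaleR scaleR_sum_right[symmetric])
  then show ?thesis by blast
qed

lemma herm_prod_sum:
  assumes "x \<in> carrier_vec n" "y \<in> carrier_vec n"
  shows "herm_prod x y = (\<Sum>r<n. conjugate (x $ r) * y $ r)"
  using assms by (simp add: herm_prod_def scalar_prod_def lessThan_atLeast0)

text \<open>The columns of \<open>Y\<close> are unit vectors, hence nonzero, and their projective
  classes form the code.\<close>

lemma code_of_gram:
  fixes Y :: "nat \<Rightarrow> nat \<Rightarrow> 'a::hermitian_scalar"
  assumes "\<And>i j. i < N \<Longrightarrow> j < N \<Longrightarrow> (\<Sum>r<n. conjugate (Y r i) * Y r j) = A i j"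
    and "\<And>i. i < N \<Longrightarrow> A i i = 1"
  shows "\<exists>R. projective_code n N R \<and> gram_of_unit_reps N R (mat N N (\<lambda>(i, j). A i j))"
proof -
  define y where "y i = vec n (\<lambda>r. Y r i)" for i
  define R where "R i = proj_rel n `` {y i}" for i
  have gram: "herm_prod (y i) (y j) = A i j" if "i < N" "j < N" for i j
  proof -
    have "herm_prod (y i) (y j) = (\<Sum>r<n. conjugate (Y r i) * Y r j)"
      by (subst herm_prod_sum[where n = n]) (simp_all add: y_def)
    with assms(1) that show ?thesis by simp
  qed
  have y: "y i \<in> carrier_vec n - {0\<^sub>v n}" if "i < N" for i
  proof -
    have "herm_prod (y i) (y i) = 1"
      using gram assms(2) that by simp
    moreover have "herm_prod (0\<^sub>v n) (0\<^sub>v n :: 'a vec) = 0"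
      by (subst herm_prod_sum[where n = n]) simp_all
    ultimately have "y i \<noteq> 0\<^sub>v n" by auto
    then show ?thesis by (simp add: y_def)
  qed
  have "projective_code n N R"
    using y by (auto simp: projective_code_def proj_space_def R_def intro: quotientI)
  moreover have "unit_rep (R i) (y i)" if "i < N" for i
    unfolding unit_rep_def R_def
    using equiv_class_self[OF equiv_proj_rel y[OF that]] gram assms(2) that by simp
  moreover have "mat N N (\<lambda>(i, j). A i j) = gram_matrix N y"
    by (rule eq_matI) (auto simp: gram_matrix_def gram)
  ultimately show ?thesis
    by (auto simp: gram_of_unit_reps_def)
qed

text \<open>The code realises the matrix with diagonal 1, other entries \<open>-c\<close> in the diagonal
  \<open>b \<times> b\<close> blocks and \<open>-c w C\<close> outside them. Its spectral decomposition is
  \<open>(1 + c) (I - blow b I) + d blow b (I - (k/M) C)\<close>, of rank \<open>b M - k\<close>; the value of \<open>c\<close> is the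
  one for which the eigenvalue on the range of \<open>blow b C\<close> vanishes.\<close>

lemma weighted_code_exists:
  fixes C :: "nat \<Rightarrow> nat \<Rightarrow> 'a::hermitian_scalar"
  assumes "0 < k" "k < M" "0 < b" "0 < w"
    and herm: "\<And>i j. i < M \<Longrightarrow> j < M \<Longrightarrow> conjugate (C i j) = C j i"
    and square: "\<And>i j. i < M \<Longrightarrow> j < M \<Longrightarrow> (\<Sum>l<M. C i l * C l j) = (real M / real k) *\<^sub>R C i j"
    and diag: "\<And>i. i < M \<Longrightarrow> C i i = 1"
    and c_def: "c = 1 / (real b * w * (real M / real k - 1) + real b - 1)"
  shows "\<exists>R A. projective_code (b * M - k) (b * M) R
      \<and> gram_of_unit_reps (b * M) R (mat (b * M) (b * M) (\<lambda>(i, j). A i j))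
      \<and> (\<forall>i<b * M. \<forall>j<b * M. i \<noteq> j \<longrightarrow>
            A i j = (if i div b = j div b then - of_real c else - (c * w) *\<^sub>R C (i div b) (j div b)))"
proof -
  define g where "g = real M / real k - 1"
  have g: "g > 0"
    using assms by (simp add: g_def)
  have den: "real b * w * g + real b - 1 > 0"
  proof -
    have "real b * w * g > 0" "real b \<ge> 1"
      using assms g by simp_all
    then show ?thesis by linarith
  qed
  have c: "c > 0" and c_eq: "c * (real b * w * g + real b - 1) = 1"
    using den by (simp_all add: c_def g_def)
  define P where "P i j = (real k / real M) *\<^sub>R C i j" for i j
  have P: "orth_proj M P"
    using assms by (simp add: orth_proj_def P_def conjugate_scaleR scaleR_sum_right[symmetric])
  \<comment> \<open>Chosen so that \<open>d / b * (k / M)\<close>, the factor of \<open>-C\<close>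
    outside the diagonal blocks, is \<open>c * w\<close>.\<close>
  define d where "d = c * w * real b * (real M / real k)"
  have d: "d > 0"
    using assms c by (simp add: d_def)
  let ?N = "b * M"
  let ?I = "\<lambda>i j. of_bool (i = j) :: 'a"
  let ?Q = "\<lambda>i j. ?I i j - blow b ?I i j"
  let ?R = "blow b (\<lambda>i j. ?I i j - P i j)"
  have "\<exists>Y. \<forall>i<?N. \<forall>j<?N. (\<Sum>r<(b * M - M) + (M - k). conjugate (Y r i) * Y r j)
      = (1 + c) *\<^sub>R ?Q i j + d *\<^sub>R ?R i j"
  \<comment> \<open>The number of rows needed for a projection is its trace:
    \<open>b * M - M\<close> for the first, \<open>M - k\<close> for the second.\<close>
  proof (rule orth_proj_pair_factor)
    show "orth_proj ?N ?Q"
      using \<open>0 < b\<close> by (intro orth_proj_complement orth_proj_blow orth_proj_id)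
    show "orth_proj ?N ?R"
      using \<open>0 < b\<close> P by (intro orth_proj_blow orth_proj_complement)
    have "M \<le> b * M"
      using \<open>0 < b\<close> by simp
    then show "(\<Sum>i<?N. ?Q i i) = of_nat (b * M - M)"
      using \<open>0 < b\<close> by (simp add: sum_subtractf trace_blow of_nat_diff)
    have "(\<Sum>i<?N. ?R i i) = of_nat M - (\<Sum>i<M. (real k / real M) *\<^sub>R 1)"
      using \<open>0 < b\<close> by (simp add: trace_blow sum_subtractf P_def diag right_diff_distrib)
    also have "(\<Sum>i<M. (real k / real M) *\<^sub>R (1 :: 'a)) = real k *\<^sub>R 1"
      using assms(2) by (simp only: sum_constant_scaleR scaleR_scaleR card_lessThan) simp
    also have "of_nat M - real k *\<^sub>R 1 = (of_nat (M - k) :: 'a)"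
      using assms(2) by (simp add: of_nat_diff scaleR_conv_of_real)
    finally show "(\<Sum>i<?N. ?R i i) = of_nat (M - k)" .
  qed (use c d in simp_all)
  moreover have "(b * M - M) + (M - k) = b * M - k"
  proof -
    have "M \<le> b * M"
      using \<open>0 < b\<close> by simp
    then show ?thesis using assms(2) by simp
  qed
  ultimately obtain Y where Y: "\<And>i j. i < ?N \<Longrightarrow> j < ?N \<Longrightarrow>
      (\<Sum>r<b * M - k. conjugate (Y r i) * Y r j) = (1 + c) *\<^sub>R ?Q i j + d *\<^sub>R ?R i j"
    by auto
  define A where "A i j = (1 + c) *\<^sub>R ?Q i j + d *\<^sub>R ?R i j" for i j
  \<comment> \<open>In a diagonal block everything apart from \<open>(1 + c) I\<close> is constant.
    The choice of \<open>c\<close> makes this constant \<open>- c\<close>, which also gives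
    \<open>A\<close> the diagonal 1.\<close>
  have block: "- (1 + c) / real b + d / real b * (1 - real k / real M) = - c"
  proof -
    have "d / real b * (1 - real k / real M) = c * w * g"
      using assms(1-3) by (simp add: d_def g_def field_simps)
    moreover have "c * w * g = (1 + c) / real b - c"
      using c_eq \<open>0 < b\<close> by (simp add: field_simps)
    ultimately show ?thesis by (simp add: diff_divide_distrib add_divide_distrib)
  qed
  have in_block: "A i j = (1 + c) *\<^sub>R of_bool (i = j) - of_real c"
    if "i < ?N" "i div b = j div b" for i j
  proof -
    have "i div b < M"
      using that(1) by (simp add: less_mult_imp_div_less mult.commute)
    then have "A i j = (1 + c) *\<^sub>R of_bool (i = j)
        + (- (1 + c) / real b + d / real b * (1 - real k / real M)) *\<^sub>R 1"
      using that(2)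
      by (simp add: A_def blow_def P_def diag algebra_simps diff_divide_distrib add_divide_distrib)
    then show ?thesis
      by (simp only: block) (simp add: of_real_def)
  qed
  have "A i i = 1" if "i < ?N" for i
    using in_block[of i i] that by (simp add: of_real_def algebra_simps)
  then obtain R where "projective_code (b * M - k) ?N R"
      "gram_of_unit_reps ?N R (mat ?N ?N (\<lambda>(i, j). A i j))"
    using code_of_gram[where Y = Y and A = A and N = ?N and n = "b * M - k"] Y
    unfolding A_def by blast
  moreover have "A i j = - (c * w) *\<^sub>R C (i div b) (j div b)" if "i div b \<noteq> j div b" for i j
  proof -
    have "d / real b * (real k / real M) = c * w"
      using assms by (simp add: d_def)
    moreover have "A i j = - (d / real b * (real k / real M)) *\<^sub>R C (i div b) (j div b)"
      using that by (auto simp: A_def blow_def P_def)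
    ultimately show ?thesis by simp
  qed
  ultimately show ?thesis
    using in_block by (intro exI[of _ R] exI[of _ A]) auto
qed

section \<open>Simplex data and the norm of the code\<close>

text \<open>There are \<open>b^2 M\<close> index pairs inside the diagonal blocks and
  \<open>b^2 M (M - 1)\<close> outside; the \<open>b M\<close> excluded diagonal pairs all lie
  inside.\<close>

lemma sum_offdiag_blocks:
  fixes h :: "bool \<Rightarrow> real"
  shows "(\<Sum>(i, j)\<in>{(i, j). i < b * M \<and> j < b * M \<and> i \<noteq> j}. h (i div b = j div b))
    = (real b)\<^sup>2 * (real M * h True + real M * (real M - 1) * h False) - real b * real M * h True"
proof -
  let ?N = "b * M"
  let ?f = "\<lambda>(i, j). h (i div b = j div b)"
  have diag: "{(i, j). i < ?N \<and> j < ?N \<and> i \<noteq> j} = {..<?N} \<times> {..<?N} - (\<lambda>i. (i, i)) ` {..<?N}"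
    by auto
  have "(\<Sum>p\<in>{..<?N} \<times> {..<?N}. ?f p) = (\<Sum>i<?N. \<Sum>j<?N. h (i div b = j div b))"
    by (simp add: sum.cartesian_product)
  also have "\<dots> = real b *\<^sub>R (\<Sum>a<M. real b *\<^sub>R (\<Sum>a'<M. h (a = a')))"
    by (simp only: sum_div_blocks[where f = "\<lambda>x. h (_ = x)"]
        sum_div_blocks[where f = "\<lambda>x. real b *\<^sub>R (\<Sum>a'<M. h (x = a'))"])
  also have "(\<Sum>a<M. real b *\<^sub>R (\<Sum>a'<M. h (a = a')))
      = (\<Sum>a<M. real b * (h True + (real M - 1) * h False))"
  proof (intro sum.cong refl)
    fix a assume a: "a \<in> {..<M}"
    have "(\<Sum>a'<M. h (a = a')) = h True + (\<Sum>a'\<in>{..<M} - {a}. h (a = a'))"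
      using sum.remove[of "{..<M}" a "\<lambda>a'. h (a = a')"] a by simp
    also have "(\<Sum>a'\<in>{..<M} - {a}. h (a = a')) = (\<Sum>a'\<in>{..<M} - {a}. h False)"
      by (intro sum.cong) auto
    also have "\<dots> = (real M - 1) * h False"
      using a by (simp add: of_nat_diff)
    finally show "real b *\<^sub>R (\<Sum>a'<M. h (a = a')) = real b * (h True + (real M - 1) * h False)"
      by simp
  qed
  finally have all: "(\<Sum>p\<in>{..<?N} \<times> {..<?N}. ?f p)
      = (real b)\<^sup>2 * (real M * h True + real M * (real M - 1) * h False)"
    by (simp add: power2_eq_square algebra_simps)
  have "(\<Sum>p\<in>(\<lambda>i. (i, i)) ` {..<?N}. ?f p) = real ?N * h True"
    by (subst sum.reindex) (auto intro: inj_onI)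
  moreover have "(\<Sum>p\<in>{..<?N} \<times> {..<?N} - (\<lambda>i. (i, i)) ` {..<?N}. ?f p)
      = (\<Sum>p\<in>{..<?N} \<times> {..<?N}. ?f p) - (\<Sum>p\<in>(\<lambda>i. (i, i)) ` {..<?N}. ?f p)"
    by (rule sum_diff) auto
  ultimately show ?thesis
    using all by (simp add: diag)
qed

text \<open>Tightness fixes \<open>\<beta>\<^sup>2\<close>, and this value makes the squared
  Frobenius norm of \<open>C\<close> equal to \<open>M^2 / k\<close>, the case handled by
  \<open>tight_gram_square\<close>.\<close>

lemma tight_simplex_gram:
  fixes P :: "nat \<Rightarrow> 'a::hermitian_scalar vec set"
  assumes "1 \<le> k" "k < M"
    and inj: "inj_on P {..<M}" and tight: "tight_simplex k (P ` {..<M})"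
    and gram: "gram_of_unit_reps M P C"
    and \<beta>: "\<forall>i<M. \<forall>j<M. i \<noteq> j \<longrightarrow> norm (C $$ (i, j)) = \<beta>"
  shows "0 < \<beta>" and "real M / real k - 1 = \<beta>\<^sup>2 * (real M - 1)"
    and "i < M \<Longrightarrow> j < M \<Longrightarrow> conjugate (C $$ (i, j)) = C $$ (j, i)"
    and "i < M \<Longrightarrow> C $$ (i, i) = 1"
    and "i < M \<Longrightarrow> j < M \<Longrightarrow>
      (\<Sum>l<M. C $$ (i, l) * C $$ (l, j)) = (real M / real k) *\<^sub>R C $$ (i, j)"
proof -
  obtain x where x: "\<And>i. i < M \<Longrightarrow> unit_rep (P i) (x i)" and C: "C = gram_matrix M x"
    using gram by (auto simp: gram_of_unit_reps_def)
  obtain \<gamma> where reg: "regular_simplex k \<gamma> (P ` {..<M})"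
    and \<gamma>: "\<gamma>\<^sup>2 = (real M - real k) / (real k * (real M - 1))"
    using tight card_image[OF inj] by (auto simp: tight_simplex_def)
  have x_carrier: "x i \<in> carrier_vec k" if "i < M" for i
  proof -
    have "P i \<in> proj_space k"
      using reg that by (auto simp: regular_simplex_def)
    then have "P i \<subseteq> carrier_vec k"
      by (auto simp: proj_space_def quotient_def proj_rel_def)
    then show ?thesis
      using x[OF that] by (auto simp: unit_rep_def)
  qed
  have C_herm_prod: "C $$ (i, j) = herm_prod (x i) (x j)" if "i < M" "j < M" for i j
    using that by (simp add: C gram_matrix_def)
  define X where "X a i = x i $ a" for a i
  \<comment> \<open>\<open>D\<close> extends \<open>C\<close> to all indices, since
    \<open>tight_gram_square\<close> asks for the factorisation without a range restriction.\<close>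
  define D where "D i j = (\<Sum>a<k. conjugate (X a i) * X a j)" for i j
  have C_sum: "C $$ (i, j) = D i j" if "i < M" "j < M" for i j
    using that by (simp add: C_herm_prod herm_prod_sum x_carrier X_def D_def)
  have D_diag: "D i i = 1" if "i < M" for i
    using that C_sum[of i i] C_herm_prod[of i i] x[of i] by (simp add: unit_rep_def)
  have "0 < M" "1 < M"
    using assms(1,2) by auto
  \<comment> \<open>As \<open>M\<close> is at least 2, the distinct points \<open>P 0\<close> and
    \<open>P 1\<close> identify \<open>\<beta>\<close> with the common value \<gamma> from
    tightness.\<close>
  have "norm (herm_prod (x 0) (x 1)) = \<gamma>"
  proof -
    have "P 0 \<noteq> P 1"
      using inj_onD[OF inj, of 0 1] \<open>0 < M\<close> \<open>1 < M\<close> by auto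
    then show ?thesis
      using reg x[OF \<open>0 < M\<close>] x[OF \<open>1 < M\<close>] \<open>0 < M\<close> \<open>1 < M\<close>
      unfolding regular_simplex_def by (meson imageI lessThan_iff)
  qed
  then have "\<beta> = \<gamma>"
    using \<beta>[rule_format, OF \<open>0 < M\<close> \<open>1 < M\<close>] C_herm_prod[OF \<open>0 < M\<close> \<open>1 < M\<close>] by simp
  then have \<beta>2: "\<beta>\<^sup>2 = (real M - real k) / (real k * (real M - 1))"
    using \<gamma> by simp
  then have "\<beta>\<^sup>2 > 0"
    using assms(1,2) by simp
  moreover have "\<beta> \<ge> 0"
    using \<beta> \<open>0 < M\<close> \<open>1 < M\<close> by (metis norm_ge_zero zero_neq_one)
  ultimately show "0 < \<beta>"
    by (simp add: less_le)
  show g: "real M / real k - 1 = \<beta>\<^sup>2 * (real M - 1)"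
    using assms(1,2) by (simp add: \<beta>2 field_simps)
  show "conjugate (C $$ (i, j)) = C $$ (j, i)" if "i < M" "j < M" for i j
    using that by (simp add: C_sum D_def conjugate_sum conjugate_mult_rev)
  show "C $$ (i, i) = 1" if "i < M" for i
    using that by (simp add: C_sum D_diag)
  have "(\<Sum>i<M. \<Sum>j<M. (norm (D i j))\<^sup>2) = (\<Sum>i<M. 1 + (real M - 1) * \<beta>\<^sup>2)"
  proof (intro sum.cong refl)
    fix i assume i: "i \<in> {..<M}"
    have "(\<Sum>j<M. (norm (D i j))\<^sup>2) = 1 + (\<Sum>j\<in>{..<M} - {i}. (norm (D i j))\<^sup>2)"
      using i sum.remove[of "{..<M}" i "\<lambda>j. (norm (D i j))\<^sup>2"] by (simp add: D_diag)
    also have "(\<Sum>j\<in>{..<M} - {i}. (norm (D i j))\<^sup>2) = (\<Sum>j\<in>{..<M} - {i}. \<beta>\<^sup>2)"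
      using i \<beta> by (intro sum.cong) (auto simp: C_sum)
    also have "\<dots> = (real M - 1) * \<beta>\<^sup>2"
      using i by (simp add: of_nat_diff)
    finally show "(\<Sum>j<M. (norm (D i j))\<^sup>2) = 1 + (real M - 1) * \<beta>\<^sup>2" .
  qed
  also have "\<dots> = real M * (1 + \<beta>\<^sup>2 * (real M - 1))"
    by (simp add: mult.commute)
  also have "\<dots> = (real M)\<^sup>2 / real k"
    by (simp only: g[symmetric]) (simp add: power2_eq_square)
  finally have "(\<Sum>l<M. D i l * D l j) = (real M / real k) *\<^sub>R D i j" for i j
    using tight_gram_square[where C = D and k = k and X = X and n = M and i = i and j = j] D_def D_diag assms(1) by auto
  then show "(\<Sum>l<M. C $$ (i, l) * C $$ (l, j)) = (real M / real k) *\<^sub>R C $$ (i, j)"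
    if "i < M" "j < M" for i j
    using that by (simp add: C_sum)
qed

text \<open>Generic in the scalars, and shaped so that each of the three cases of the theorem is an
  instance.\<close>

lemma tight_simplex_codes:
  fixes P :: "nat \<Rightarrow> 'a::hermitian_scalar vec set"
  assumes k: "1 \<le> k" "k < M" and b: "1 \<le> b"
    and simplex: "inj_on P {..<M} \<and> tight_simplex k (P ` {..<M}) \<and> gram_of_unit_reps M P C \<and>
      (\<forall>i<M. \<forall>j<M. i \<noteq> j \<longrightarrow> norm (C $$ (i, j)) = \<beta>)"
  shows "(\<forall>p::real. p \<noteq> 0 \<and> p \<noteq> 1 \<longrightarrow>
        (\<exists>(R :: nat \<Rightarrow> 'a vec set) (A :: 'a mat).
          projective_code (b * M - k) (b * M) R \<and> gram_of_unit_reps (b * M) R A \<and>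
          offdiag_norm p A =
            real (b * M) /
              ((real (b * M))\<^sup>2 * (\<beta> powr (p / (p - 1)) + 1 / real M * (1 - \<beta> powr (p / (p - 1))))
                - real (b * M)) powr (1 - 1 / p))) \<and>
      (\<exists>(R :: nat \<Rightarrow> 'a vec set) (A :: 'a mat).
        projective_code (b * M - k) (b * M) R \<and> gram_of_unit_reps (b * M) R A \<and>
        offdiag_max A =
          real (b * M) /
            ((real (b * M))\<^sup>2 * (\<beta> + 1 / real M * (1 - \<beta>)) - real (b * M)))"
proof -
  note data = tight_simplex_gram[OF k, of P C \<beta>]
  have \<beta>: "0 < \<beta>" and g: "real M / real k - 1 = \<beta>\<^sup>2 * (real M - 1)"
    using data(1,2) simplex by blast+
  \<comment> \<open>The sum of the \<open>q\<close>-th powers of the off-diagonal moduli of the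
    blown-up Gram matrix.\<close>
  define S where "S q = (real (b * M))\<^sup>2 * (\<beta> powr q + 1 / real M * (1 - \<beta> powr q)) - real (b * M)"
    for q
  let ?N = "b * M"
  have N: "2 \<le> ?N"
    using k b mult_le_mono[of 1 b 2 M] by simp
  have S_eq: "S q = real ?N * (real b * (real M - 1) * \<beta> powr q + real b - 1)" for q
    using k by (simp add: S_def power2_eq_square field_simps)
  have S_pos: "S q > 0" for q
  proof -
    have "real b * (real M - 1) * \<beta> powr q > 0"
      using k b \<beta> by simp
    then have "real b * (real M - 1) * \<beta> powr q + real b - 1 > 0"
      using b by linarith
    then show ?thesis
      unfolding S_eq using k b by (intro mult_pos_pos) simp_all
  qed
  have code: "\<exists>R A. projective_code (?N - k) ?N R
      \<and> gram_of_unit_reps ?N R (mat ?N ?N (\<lambda>(i, j). A i j :: 'a))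
      \<and> (\<forall>i<?N. \<forall>j<?N. i \<noteq> j \<longrightarrow>
          norm (A i j) = real ?N / S q * (if i div b = j div b then 1 else \<beta> powr (q - 1)))" for q
  proof -
    \<comment> \<open>The Hoelder weight \<open>|G_ij| powr (q - 2)\<close> outside the diagonal
      blocks; inside them the modulus, hence the weight, is 1.\<close>
    define w where "w = \<beta> powr (q - 2)"
    have w: "w > 0" "w * \<beta>\<^sup>2 = \<beta> powr q" "w * \<beta> = \<beta> powr (q - 1)"
      using \<beta> powr_add[of \<beta> "q - 2" 2] powr_add[of \<beta> "q - 2" 1] by (simp_all add: w_def)
    have "real b * w * (real M / real k - 1) + real b - 1 = real b * (real M - 1) * (w * \<beta>\<^sup>2) + real b - 1"
      by (simp add: g)
    then have "S q = real ?N * (real b * w * (real M / real k - 1) + real b - 1)"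
      by (simp only: S_eq w(2))
    \<comment> \<open>The constant of \<open>weighted_code_exists\<close>, forced there by the
      vanishing eigenvalue, is \<open>b M / S q\<close>.\<close>
    then have c: "real ?N / S q = 1 / (real b * w * (real M / real k - 1) + real b - 1)"
      using N k b by simp
    obtain R A where RA: "projective_code (?N - k) ?N R"
        "gram_of_unit_reps ?N R (mat ?N ?N (\<lambda>(i, j). A i j :: 'a))"
      and A: "\<And>i j. i < ?N \<Longrightarrow> j < ?N \<Longrightarrow> i \<noteq> j \<Longrightarrow> A i j = (if i div b = j div b
          then - of_real (real ?N / S q) else - (real ?N / S q * w) *\<^sub>R C $$ (i div b, j div b))"
      using weighted_code_exists[of k M b w "\<lambda>i j. C $$ (i, j)", OF _ _ _ _ _ _ _ c] data(3-5) simplex k b w(1)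
      by (auto simp del: of_nat_mult)
    have "norm (A i j) = real ?N / S q * (if i div b = j div b then 1 else \<beta> powr (q - 1))"
      if "i < ?N" "j < ?N" "i \<noteq> j" for i j
    proof -
      have "i div b < M" "j div b < M"
        using that by (simp_all add: less_mult_imp_div_less mult.commute)
      then have "norm (C $$ (i div b, j div b)) = \<beta>" if "i div b \<noteq> j div b"
        using simplex that by blast
      then show ?thesis
        using that S_pos[of q] w(1) by (auto simp: A w(3)[symmetric] abs_mult simp del: of_real_divide of_nat_mult)
    qed
    with RA show ?thesis by blast
  qed
  have "\<exists>R A. projective_code (?N - k) ?N R \<and> gram_of_unit_reps ?N R (A :: 'a mat) \<and>
      offdiag_norm p A = real ?N / S (p / (p - 1)) powr (1 - 1 / p)" if p: "p \<noteq> 0" "p \<noteq> 1" for p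
  proof -
    define q where "q = p / (p - 1)"
    \<comment> \<open>Conjugacy of the exponents: the \<open>p\<close>-th power of
      \<open>\<beta> powr (q - 1)\<close> is \<open>\<beta> powr q\<close>, so the sum of
      \<open>p\<close>-th powers becomes \<open>c powr p * S q\<close>. This holds for negative
      \<open>p\<close> as well.\<close>
    have q: "(q - 1) * p = q"
      using p by (simp add: q_def field_simps)
    define c where "c = real ?N / S q"
    have c: "c > 0"
      using S_pos[of q] k b by (simp add: c_def)
    obtain R A where RA: "projective_code (?N - k) ?N R"
        "gram_of_unit_reps ?N R (mat ?N ?N (\<lambda>(i, j). A i j :: 'a))"
      and A: "\<And>i j. i < ?N \<Longrightarrow> j < ?N \<Longrightarrow> i \<noteq> j \<Longrightarrow>
        norm (A i j) = c * (if i div b = j div b then 1 else \<beta> powr (q - 1))"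
      using code[of q] unfolding c_def by blast
    \<comment> \<open>Rules out the branch of \<open>offdiag_norm\<close> for negative
      \<open>p\<close> and a vanishing entry.\<close>
    have nz: "A i j \<noteq> 0" if "i < ?N" "j < ?N" "i \<noteq> j" for i j
    proof -
      have "norm (A i j) > 0"
        using A[OF that] c \<beta> by simp
      then show ?thesis by auto
    qed
    define h where "h s = (if s then c powr p else c powr p * \<beta> powr q)" for s
    let ?off = "{(i, j). i < ?N \<and> j < ?N \<and> i \<noteq> j}"
    have "(\<Sum>(i, j)\<in>?off. norm (A i j) powr p) = (\<Sum>(i, j)\<in>?off. h (i div b = j div b))"
      using c \<beta> by (intro sum.cong refl) (auto simp: A h_def powr_mult powr_powr q)
    also have "\<dots> = c powr p * S q"
      unfolding sum_offdiag_blocks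
      by (simp add: h_def S_eq power2_eq_square algebra_simps)
    finally have sum: "(\<Sum>(i, j)\<in>?off. norm (A i j) powr p) = c powr p * S q" .
    have "offdiag_norm p (mat ?N ?N (\<lambda>(i, j). A i j)) = (\<Sum>(i, j)\<in>?off. norm (A i j) powr p) powr (1 / p)"
      using nz by (auto simp: offdiag_norm_def intro!: arg_cong[where f = "\<lambda>x. x powr _"] sum.cong)
    also have "\<dots> = c * S q powr (1 / p)"
      using c S_pos[of q] p by (simp add: sum powr_mult powr_powr)
    also have "\<dots> = real ?N / S q powr (1 - 1 / p)"
      using S_pos[of q] by (simp add: c_def powr_diff)
    finally show ?thesis
      using RA unfolding q_def by blast
  qed
  moreover have "\<exists>R A. projective_code (?N - k) ?N R \<and> gram_of_unit_reps ?N R (A :: 'a mat) \<and>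
      offdiag_max A = real ?N / S 1"
  proof -
    \<comment> \<open>For \<open>p = \<infinity>\<close> the conjugate exponent is 1, and
      \<open>\<beta> powr 0 = 1\<close> makes all off-diagonal moduli equal.\<close>
    obtain R A where RA: "projective_code (?N - k) ?N R"
        "gram_of_unit_reps ?N R (mat ?N ?N (\<lambda>(i, j). A i j :: 'a))"
      and A: "\<And>i j. i < ?N \<Longrightarrow> j < ?N \<Longrightarrow> i \<noteq> j \<Longrightarrow> norm (A i j) = real ?N / S 1"
      using code[of 1] \<beta> by auto
    have "0 < ?N" "1 < ?N"
      using N by linarith+
    define B where "B = mat ?N ?N (\<lambda>(i, j). A i j)"
    have B: "norm (B $$ (i, j)) = real ?N / S 1" if "i < ?N" "j < ?N" "i \<noteq> j" for i j
      using that A by (simp add: B_def)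
    define entries where "entries = {norm (B $$ (i, j)) | i j. i < ?N \<and> j < ?N \<and> i \<noteq> j}"
    \<comment> \<open>The maximum is over a nonempty set because \<open>b * M\<close> is at least
      2.\<close>
    have "norm (B $$ (0, 1)) \<in> entries"
      unfolding entries_def using \<open>0 < ?N\<close> \<open>1 < ?N\<close> zero_neq_one[where 'a = nat] by blast
    moreover have "entries \<subseteq> {real ?N / S 1}"
      unfolding entries_def using B by blast
    ultimately have "entries = {real ?N / S 1}"
      by (metis empty_iff subset_singletonD)
    then have "offdiag_max B = real ?N / S 1"
      by (simp add: offdiag_max_def entries_def B_def)
    with RA show ?thesis unfolding B_def by blast
  qed
  ultimately show ?thesis
    using \<beta> by (simp add: S_def)
qed

theorem theorem10:
  fixes M k b :: nat and \<beta> :: real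
  assumes "1 \<le> k" and "k < M" and "1 \<le> b"
  shows
   "(\<forall>(P :: nat \<Rightarrow> real vec set) (C :: real mat).
      inj_on P {..<M} \<and> tight_simplex k (P ` {..<M}) \<and> gram_of_unit_reps M P C \<and>
      (\<forall>i<M. \<forall>j<M. i \<noteq> j \<longrightarrow> norm (C $$ (i, j)) = \<beta>) \<longrightarrow>
      (\<forall>p::real. p \<noteq> 0 \<and> p \<noteq> 1 \<longrightarrow>
        (\<exists>(R :: nat \<Rightarrow> real vec set) (A :: real mat).
          projective_code (b * M - k) (b * M) R \<and> gram_of_unit_reps (b * M) R A \<and>
          offdiag_norm p A =
            real (b * M) /
              ((real (b * M))\<^sup>2 * (\<beta> powr (p / (p - 1)) + 1 / real M * (1 - \<beta> powr (p / (p - 1))))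
                - real (b * M)) powr (1 - 1 / p))) \<and>
      (\<exists>(R :: nat \<Rightarrow> real vec set) (A :: real mat).
        projective_code (b * M - k) (b * M) R \<and> gram_of_unit_reps (b * M) R A \<and>
        offdiag_max A =
          real (b * M) /
            ((real (b * M))\<^sup>2 * (\<beta> + 1 / real M * (1 - \<beta>)) - real (b * M)))) \<and>
    (\<forall>(P :: nat \<Rightarrow> complex vec set) (C :: complex mat).
      inj_on P {..<M} \<and> tight_simplex k (P ` {..<M}) \<and> gram_of_unit_reps M P C \<and>
      (\<forall>i<M. \<forall>j<M. i \<noteq> j \<longrightarrow> norm (C $$ (i, j)) = \<beta>) \<longrightarrow>
      (\<forall>p::real. p \<noteq> 0 \<and> p \<noteq> 1 \<longrightarrow>
        (\<exists>(R :: nat \<Rightarrow> complex vec set) (A :: complex mat).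
          projective_code (b * M - k) (b * M) R \<and> gram_of_unit_reps (b * M) R A \<and>
          offdiag_norm p A =
            real (b * M) /
              ((real (b * M))\<^sup>2 * (\<beta> powr (p / (p - 1)) + 1 / real M * (1 - \<beta> powr (p / (p - 1))))
                - real (b * M)) powr (1 - 1 / p))) \<and>
      (\<exists>(R :: nat \<Rightarrow> complex vec set) (A :: complex mat).
        projective_code (b * M - k) (b * M) R \<and> gram_of_unit_reps (b * M) R A \<and>
        offdiag_max A =
          real (b * M) /
            ((real (b * M))\<^sup>2 * (\<beta> + 1 / real M * (1 - \<beta>)) - real (b * M)))) \<and>
    (\<forall>(P :: nat \<Rightarrow> quat vec set) (C :: quat mat).
      inj_on P {..<M} \<and> tight_simplex k (P ` {..<M}) \<and> gram_of_unit_reps M P C \<and>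
      (\<forall>i<M. \<forall>j<M. i \<noteq> j \<longrightarrow> norm (C $$ (i, j)) = \<beta>) \<longrightarrow>
      (\<forall>p::real. p \<noteq> 0 \<and> p \<noteq> 1 \<longrightarrow>
        (\<exists>(R :: nat \<Rightarrow> quat vec set) (A :: quat mat).
          projective_code (b * M - k) (b * M) R \<and> gram_of_unit_reps (b * M) R A \<and>
          offdiag_norm p A =
            real (b * M) /
              ((real (b * M))\<^sup>2 * (\<beta> powr (p / (p - 1)) + 1 / real M * (1 - \<beta> powr (p / (p - 1))))
                - real (b * M)) powr (1 - 1 / p))) \<and>
      (\<exists>(R :: nat \<Rightarrow> quat vec set) (A :: quat mat).
        projective_code (b * M - k) (b * M) R \<and> gram_of_unit_reps (b * M) R A \<and>
        offdiag_max A =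
          real (b * M) /
            ((real (b * M))\<^sup>2 * (\<beta> + 1 / real M * (1 - \<beta>)) - real (b * M))))"
  by (rule conjI[OF _ conjI]; intro allI impI; rule tight_simplex_codes[OF assms])

end
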